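(* $\{\mathbf f_1,\ldots,\mathbf f_s\}\subset\mathbb Z[x]^n$ is a reduced Gröbner basis such that $\mathbf f_1<\mathbf f_2<\cdots<\mathbf f_s$ if and only if its matrix representation, the matrix $[\mathbf f_1,\ldots,\mathbf f_s]_{n\times s}$ with $i$-th column $\mathbf f_i$, is a generalized Hermite normal form.
   Context: Let $\epsilon_1,\ldots,\epsilon_n$ be the standard basis of $\mathbb Z[x]^n$. Monomials $ax^k\epsilon_i$ ($a\in\mathbb Z$, $k\in\mathbb N$) are ordered by $ax^\alpha\epsilon_i>bx^\beta\epsilon_j$ if $i>j$, or $i=j$ and $\alpha>\beta$, or $i=j$, $\alpha=\beta$, $|a|>|b|$. Writing $\mathbf f$ as the sum of its nonzero monomials (with distinct $x^k\epsilon_i$), the leading term $\mathbf{LT}(\mathbf f)$ is the largest of them; $\mathbf{LT}(G)$ is the set of leading terms of the elements of $G$. For vectors, $\mathbf f<\mathbf g$ iff $\mathbf{LT}(\mathbf f)<\mathbf{LT}(\mathbf g)$. A finite set $F\subset\mathbb Z[x]^n$ is a Gröbner basis for the $\mathbb Z[x]$-module $L$ generated by $F$ if $(\mathbf{LT}(L))=(\mathbf{LT}(F))$, where $(\cdot)$ denotes the generated $\mathbb Z[x]$-module. A vector $\mathbf f$ is G-reduced with respect to a set $G$ if no monomial of $\mathbf f$ is a multiple of $\mathbf{LT}(\mathbf g)$ by an element of $\mathbb Z[x]$, for any $\mathbf g\in G$. A Gröbner basis $F$ is reduced if each $\mathbf f\in F$ is G-reduced with respect to $F\setminus\{\mathbf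 f\}$. A vector can be reduced to zero by $G$ if its normal form with respect to $G$ (the vector obtained by successively subtracting $\mathbb Z[x]$-multiples of elements of $G$, using their leading terms, until the result is G-reduced with respect to $G$) is $0$. Generalized Hermite normal form: a matrix over $\mathbb Z[x]$ in column-block echelon shape: there are indices $1\le r_1<r_2<\cdots<r_t$ and positive integers $l_1,\ldots,l_t$ with $s=l_1+\cdots+l_t$ such that the columns are, in order, $\mathbf c_{r_1,1},\ldots,\mathbf c_{r_1,l_1},\mathbf c_{r_2,1},\ldots,\mathbf c_{r_2,l_2},\ldots,\mathbf c_{r_t,1},\ldots,\mathbf c_{r_t,l_t}$, where each $\mathbf c_{r_i,j}$ has a nonzero entry $c_{r_i,j}$ in row $r_i$ and zeros in all rows below $r_i$. Write $c_{r_i,j}=c_{r_i,j,0}x^{d_{r_i,j}}+(\text{lower degree})$ with $c_{r_i,j,0}\ne0$, so the leading monomial of $\mathbf c_{r_i,j}$ is $c_{r_i,j,0}x^{d_{r_i,j}}\epsilon_{r_i}$. It is required that: 1) $0\le d_{r_i,1}<d_{r_i,2}<\cdots<d_{r_i,l_i}$ for all $i$; 2) $c_{r_i,l_i,0}\mid\cdots\mid c_{r_i,2,0}\mid c_{r_i,1,0}$ for all $i$; 3) $x^{d_{r_i,j_2}-d_{r_i,j_1}}\mathbf c_{r_i,j_1}-\frac{c_{r_i,j_1,0}}{c_{r_i,j_2,0}}\mathbf c_{r_i,j_2}$ can be reduced to zero by the column vectors of the matrix for all $1\le i\le t$, $1\le j_1<j_2\le l_i$; 4) each $\mathbf c_{r_i,j}$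 is G-reduced with respect to the column vectors of the matrix other than $\mathbf c_{r_i,j}$, for all $1\le i\le t$, $1\le j\le l_i$.
   Formalization: "Gröbner basis" is taken in the strong sense: every leading term of a nonzero element of L is a multiple of LT(f) for a single f in F. With only (LT(L)) = (LT(F)) the claim fails: {2,3} in Z[x] is reduced with 2<3, but [2,3] is no generalized Hermite normal form. Basis vectors are nonzero. *)

theory Defs
  imports "Jordan_Normal_Form.VS_Connect"
begin

text \<open>
  Elements of \<open>\<int>[x]\<^sup>n\<close> are vectors in \<open>carrier_vec n\<close> over \<^typ>\<open>int poly\<close>.  Vector entries are
  indexed from 0, so \<open>\<epsilon>\<^sub>i\<close> is \<open>unit_vec n (i - 1)\<close>.
  The monomial \<open>a x\<^sup>k \<epsilon>\<close> with \<open>\<epsilon>\<close> in position \<open>i\<close> (counted from 0) is encoded as the triple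
  \<open>(a, k, i)\<close>.
\<close>

abbreviation module_span :: "nat \<Rightarrow> int poly vec set \<Rightarrow> int poly vec set" where
  "module_span n S \<equiv> LinearCombinations.module.span class_ring (module_vec TYPE(int poly) n) S"

type_synonym monomial = "int \<times> nat \<times> nat"

fun monomial_vec :: "nat \<Rightarrow> monomial \<Rightarrow> int poly vec" where
  "monomial_vec n (a, k, i) = monom a k \<cdot>\<^sub>v unit_vec n i"

fun monomial_less :: "monomial \<Rightarrow> monomial \<Rightarrow> bool" where
  "monomial_less (b, \<beta>, j) (a, \<alpha>, i) \<longleftrightarrow>
     j < i \<or> (j = i \<and> \<beta> < \<alpha>) \<or> (j = i \<and> \<beta> = \<alpha> \<and> \<bar>b\<bar> < \<bar>a\<bar>)"

definition monomials :: "int poly vec \<Rightarrow> monomial set" where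
  "monomials f = {(a, k, i). i < dim_vec f \<and> a = coeff (f $ i) k \<and> a \<noteq> 0}"

text \<open>The leading monomial is meaningful only for nonzero vectors.\<close>

definition lead_monomial :: "int poly vec \<Rightarrow> monomial" where
  "lead_monomial f =
     (THE m. m \<in> monomials f \<and> (\<forall>m' \<in> monomials f. m' \<noteq> m \<longrightarrow> monomial_less m' m))"

definition LT :: "int poly vec \<Rightarrow> int poly vec" where
  "LT f = monomial_vec (dim_vec f) (lead_monomial f)"

definition LTs :: "int poly vec set \<Rightarrow> int poly vec set" where
  "LTs G = LT ` {g \<in> G. g \<noteq> 0\<^sub>v (dim_vec g)}"

definition vec_less :: "int poly vec \<Rightarrow> int poly vec \<Rightarrow> bool" where
  "vec_less f g \<longleftrightarrow> monomial_less (lead_monomial f) (lead_monomial g)"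

definition multiple_of :: "int poly vec \<Rightarrow> int poly vec \<Rightarrow> bool" where
  "multiple_of u v \<longleftrightarrow> (\<exists>p. u = p \<cdot>\<^sub>v v)"

definition G_reduced :: "int poly vec set \<Rightarrow> int poly vec \<Rightarrow> bool" where
  "G_reduced G f \<longleftrightarrow>
     (\<forall>m \<in> monomials f. \<forall>u \<in> LTs G. \<not> multiple_of (monomial_vec (dim_vec f) m) u)"

text \<open>
  One reduction step cancels a monomial of the vector that is a multiple of a leading term.
  A normal form is the G-reduced end point of a sequence of such steps; in general it depends on
  the choices made, so it is a relation.
\<close>

definition reduction_step :: "int poly vec set \<Rightarrow> int poly vec \<Rightarrow> int poly vec \<Rightarrow> bool" where
  "reduction_step G f h \<longleftrightarrow>
     (\<exists>g \<in> G. \<exists>m \<in> monomials f. \<exists>p. g \<noteq> 0\<^sub>v (dim_vec g) \<and>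
        monomial_vec (dim_vec f) m = p \<cdot>\<^sub>v LT g \<and> h = f - p \<cdot>\<^sub>v g)"

definition normal_form :: "int poly vec set \<Rightarrow> int poly vec \<Rightarrow> int poly vec \<Rightarrow> bool" where
  "normal_form G f h \<longleftrightarrow> (reduction_step G)\<^sup>*\<^sup>* f h \<and> G_reduced G h"

definition reduces_to_zero :: "int poly vec set \<Rightarrow> int poly vec \<Rightarrow> bool" where
  "reduces_to_zero G f \<longleftrightarrow> normal_form G f (0\<^sub>v (dim_vec f))"

text \<open>
  Basis elements must be nonzero, since otherwise they have no leading term.
\<close>

definition groebner_basis :: "nat \<Rightarrow> int poly vec set \<Rightarrow> bool" where
  "groebner_basis n F \<longleftrightarrow>
     finite F \<and> F \<subseteq> carrier_vec n \<and> 0\<^sub>v n \<notin> F \<and>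
     module_span n (LTs (module_span n F)) = module_span n (LTs F)"

text \<open>
  Equality of the modules generated by the leading terms does not make the leading term of each
  nonzero element of the module a multiple of a single leading term of the basis, because the
  coefficients are integers: \<open>{2, 3}\<close> in \<open>\<int>[x]\<close> satisfies \<^const>\<open>groebner_basis\<close>, and each of its
  elements is G-reduced with respect to the other, but 1 is a multiple of neither; the matrix
  \<open>[2, 3]\<close> is not a generalized Hermite normal form.  The correspondence with generalized Hermite
  normal forms therefore needs Groebner bases in the strong sense, in which every leading term of
  the module is a multiple of a leading term of the basis.
\<close>

definition strong_groebner_basis :: "nat \<Rightarrow> int poly vec set \<Rightarrow> bool" where
  "strong_groebner_basis n F \<longleftrightarrow>
     groebner_basis n F \<and> (\<forall>u \<in> LTs (module_span n F). \<exists>v \<in> LTs F. multiple_of u v)"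

definition reduced_groebner_basis :: "nat \<Rightarrow> int poly vec set \<Rightarrow> bool" where
  "reduced_groebner_basis n F \<longleftrightarrow>
     strong_groebner_basis n F \<and> (\<forall>f \<in> F. G_reduced (F - {f}) f)"

text \<open>
  All indices are counted from 0: the blocks are \<open>i < t\<close>, the columns of block \<open>i\<close> are \<open>j < l i\<close>,
  and \<open>r i\<close> is the row of the pivots of block \<open>i\<close>.  The matrix without columns (\<open>t = 0\<close>) is
  allowed; it corresponds to the empty basis of the zero module.
\<close>

definition block_col :: "int poly mat \<Rightarrow> (nat \<Rightarrow> nat) \<Rightarrow> nat \<Rightarrow> nat \<Rightarrow> int poly vec" where
  "block_col A l i j = col A ((\<Sum>k<i. l k) + j)"

definition block_echelon ::
  "int poly mat \<Rightarrow> nat \<Rightarrow> (nat \<Rightarrow> nat) \<Rightarrow> (nat \<Rightarrow> nat) \<Rightarrow> bool" where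
  "block_echelon A t r l \<longleftrightarrow>
     (\<forall>i<t. r i < dim_row A \<and> 0 < l i) \<and>
     (\<forall>i1 i2. i1 < i2 \<longrightarrow> i2 < t \<longrightarrow> r i1 < r i2) \<and>
     dim_col A = (\<Sum>i<t. l i) \<and>
     (\<forall>i<t. \<forall>j<l i. block_col A l i j $ r i \<noteq> 0 \<and>
        (\<forall>k. r i < k \<longrightarrow> k < dim_row A \<longrightarrow> block_col A l i j $ k = 0))"

definition generalized_hermite_normal_form :: "int poly mat \<Rightarrow> bool" where
  "generalized_hermite_normal_form A \<longleftrightarrow>
     (\<exists>t r l. block_echelon A t r l \<and>
       (let C = set (cols A);
            c = block_col A l;
            d = (\<lambda>i j. degree (c i j $ r i));
            a = (\<lambda>i j. lead_coeff (c i j $ r i))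
        in (\<forall>i<t. \<forall>j1 j2. j1 < j2 \<longrightarrow> j2 < l i \<longrightarrow> d i j1 < d i j2) \<and>
           (\<forall>i<t. \<forall>j1 j2. j1 < j2 \<longrightarrow> j2 < l i \<longrightarrow> a i j2 dvd a i j1) \<and>
           (\<forall>i<t. \<forall>j1 j2. j1 < j2 \<longrightarrow> j2 < l i \<longrightarrow>
              reduces_to_zero C
                (monom 1 (d i j2 - d i j1) \<cdot>\<^sub>v c i j1 - [:a i j1 div a i j2:] \<cdot>\<^sub>v c i j2)) \<and>
           (\<forall>i<t. \<forall>j<l i. G_reduced (C - {c i j}) (c i j))))"

end

theory Submission
  imports Defs "HOL-Library.Product_Lexorder"
begin

text \<open>
Call the pair \<open>(i, k)\<close> the position of the monomial \<open>a x\<^sup>k \<epsilon>\<close> with \<open>\<epsilon>\<close> in row \<open>i\<close>.  Ordered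
lexicographically, the positions form a well-order, and the leading monomial of a nonzero vector is
the one at its largest position; comparing absolute values of coefficients is only relevant for
vectors with the same leading position.

From a normal form to a Groebner basis.  Let \<open>C\<close> be the set of columns.  For every position
\<open>P = (i, k)\<close> that the leading monomial of some \<open>x\<^sup>e c\<close> with \<open>c \<in> C\<close> can reach, let \<open>b\<^sub>P\<close> be the multiple
\<open>x\<^sup>e c\<close> that reaches \<open>P\<close> and comes from the column \<open>c\<close> of largest leading degree.  By the
divisibility chain its leading coefficient divides those of all multiples that reach \<open>P\<close>.  The vectors
\<open>b\<^sub>P\<close> have distinct leading positions, so a nonzero \<open>\<int>\<close>-linear combination of them cannot lose its
largest summand: its leading term is an integer multiple of the leading term of one \<open>b\<^sub>P\<close>.  It
therefore suffices that the \<open>b\<^sub>P\<close> span the whole module over \<open>\<int>\<close>, that is, that every \<open>x\<^sup>e c\<close> lies in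
their \<open>\<int>\<close>-span.  This holds by induction on the leading position \<open>P\<close> of \<open>x\<^sup>e c\<close>: the difference of
\<open>x\<^sup>e c\<close> and a multiple of \<open>b\<^sub>P\<close> is a multiple of an S-vector of two columns in the same block.  A
reduction of that S-vector to zero writes it as a sum of monomial multiples of columns with leading
positions below \<open>P\<close>, to which the induction hypothesis applies.  S-vectors inside a
block suffice because columns of different blocks have leading monomials in different rows.  This is
\<open>hermite_pairs_lead_divides\<close>, with the \<open>\<int>\<close>-span described by \<open>echelon_sums\<close>.

From a Groebner basis to a normal form.  Let \<open>c\<close>, \<open>c'\<close> be basis elements with leading monomials in the
same row and degrees \<open>d \<le> d'\<close>.  By Bezout the module contains a vector with leading degree \<open>d'\<close> whose
leading coefficient is the gcd of those of \<open>c\<close> and \<open>c'\<close>.  Its leading term is a multiple of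
the leading term of some basis element, which then also divides that of \<open>c'\<close>, and hence is \<open>c'\<close> itself
because the basis is reduced.  So the leading coefficient of \<open>c'\<close> divides that of \<open>c\<close>, and \<open>d = d'\<close> is
impossible, since then \<open>c\<close> would not be reduced with respect to \<open>c'\<close>.  S-vectors reduce to zero because
they lie in the module (\<open>strong_reduced_hermite_pairs\<close>).

What remains is bookkeeping: the block shape of the matrix and the growth of the degrees inside its
blocks say exactly that the leading positions of the columns increase (\<open>generalized_hermite_normal_form_iff\<close>).
\<close>

section \<open>Positions of monomials\<close>

definition support :: "int poly vec \<Rightarrow> (nat \<times> nat) set" where
  "support f = {(i, k). i < dim_vec f \<and> coeff (f $ i) k \<noteq> 0}"

definition coeff_at :: "int poly vec \<Rightarrow> nat \<times> nat \<Rightarrow> int" where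
  "coeff_at f P = coeff (f $ fst P) (snd P)"

definition lead_pos :: "int poly vec \<Rightarrow> nat \<times> nat" where
  "lead_pos f = Max (support f)"

abbreviation lead_coefficient :: "int poly vec \<Rightarrow> int" where
  "lead_coefficient f \<equiv> coeff_at f (lead_pos f)"

text \<open>
Divisibility of the monomial with coefficient \<open>a\<close> at position \<open>P\<close> by the leading term of \<open>g\<close>.
\<close>

definition lead_divides :: "int poly vec \<Rightarrow> int \<Rightarrow> nat \<times> nat \<Rightarrow> bool" where
  "lead_divides g a P \<longleftrightarrow>
     fst (lead_pos g) = fst P \<and> snd (lead_pos g) \<le> snd P \<and> lead_coefficient g dvd a"

lemma finite_support: "finite (support f)"
proof (rule finite_subset)
  show "support f \<subseteq> (SIGMA i:{..<dim_vec f}. {..degree (f $ i)})"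
    by (auto simp: support_def le_degree)
qed simp

lemma in_support_iff: "P \<in> support f \<longleftrightarrow> fst P < dim_vec f \<and> coeff_at f P \<noteq> 0"
  by (cases P) (simp add: support_def coeff_at_def)

lemma support_zero [simp]: "support (0\<^sub>v n) = {}"
  by (auto simp: support_def)

lemma support_empty_iff: "f \<in> carrier_vec n \<Longrightarrow> support f = {} \<longleftrightarrow> f = 0\<^sub>v n"
proof
  assume f: "f \<in> carrier_vec n" and "support f = {}"
  then have "\<And>i k. i < n \<Longrightarrow> coeff (f $ i) k = 0"
    by (auto simp: support_def)
  then show "f = 0\<^sub>v n" using f by (intro eq_vecI) (auto intro: poly_eqI)
qed simp

lemma lead_pos_in_support:
  "f \<in> carrier_vec n \<Longrightarrow> f \<noteq> 0\<^sub>v n \<Longrightarrow> lead_pos f \<in> support f"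
  unfolding lead_pos_def by (rule Max_in) (simp_all add: finite_support support_empty_iff)

lemma le_lead_pos: "P \<in> support f \<Longrightarrow> P \<le> lead_pos f"
  unfolding lead_pos_def by (rule Max_ge) (simp_all add: finite_support)

lemma lead_pos_eqI: "P \<in> support f \<Longrightarrow> (\<And>Q. Q \<in> support f \<Longrightarrow> Q \<le> P) \<Longrightarrow> lead_pos f = P"
  unfolding lead_pos_def by (rule Max_eqI) (simp_all add: finite_support)

lemma lead_coefficient_nonzero:
  "f \<in> carrier_vec n \<Longrightarrow> f \<noteq> 0\<^sub>v n \<Longrightarrow> lead_coefficient f \<noteq> 0"
  using lead_pos_in_support by (auto simp: in_support_iff)

lemma fst_lead_pos_less:
  "f \<in> carrier_vec n \<Longrightarrow> f \<noteq> 0\<^sub>v n \<Longrightarrow> fst (lead_pos f) < n"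
  using lead_pos_in_support by (fastforce simp: in_support_iff)

section \<open>Leading terms and reduction in terms of positions\<close>

lemma monomials_eq: "monomials f = (\<lambda>P. (coeff_at f P, snd P, fst P)) ` support f"
  by (force simp: monomials_def support_def coeff_at_def image_iff)

lemma lead_monomial_eq:
  assumes "f \<in> carrier_vec n" "f \<noteq> 0\<^sub>v n"
  shows "lead_monomial f = (lead_coefficient f, snd (lead_pos f), fst (lead_pos f))"
  unfolding lead_monomial_def
proof (rule the_equality)
  have lp: "lead_pos f \<in> support f" using assms by (rule lead_pos_in_support)
  let ?m = "(lead_coefficient f, snd (lead_pos f), fst (lead_pos f))"
  have m: "?m \<in> monomials f" unfolding monomials_eq using lp by blast
  have less: "monomial_less m' ?m" if m': "m' \<in> monomials f" "m' \<noteq> ?m" for m'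
  proof -
    obtain P where P: "P \<in> support f" "m' = (coeff_at f P, snd P, fst P)"
      using m'(1) unfolding monomials_eq by blast
    moreover have "P \<noteq> lead_pos f" using m'(2) P by auto
    ultimately have "P < lead_pos f" using le_lead_pos by fastforce
    then show ?thesis using P by (auto simp: less_prod_def)
  qed
  then show "?m \<in> monomials f \<and> (\<forall>m'\<in>monomials f. m' \<noteq> ?m \<longrightarrow> monomial_less m' ?m)"
    using m by blast
  fix m assume *: "m \<in> monomials f \<and> (\<forall>m'\<in>monomials f. m' \<noteq> m \<longrightarrow> monomial_less m' m)"
  show "m = ?m"
  proof (rule ccontr)
    assume "m \<noteq> ?m"
    then have "monomial_less ?m m" using * m by metis
    moreover have "monomial_less m ?m" using less[of m] * \<open>m \<noteq> ?m\<close> by metis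
    ultimately show False by (cases m) auto
  qed
qed

lemma LT_eq:
  assumes "f \<in> carrier_vec n" "f \<noteq> 0\<^sub>v n"
  shows "LT f = monom (lead_coefficient f) (snd (lead_pos f)) \<cdot>\<^sub>v unit_vec n (fst (lead_pos f))"
  unfolding LT_def lead_monomial_eq[OF assms] using assms(1) by simp

text \<open>
Position and coefficient have to be kept apart: the order on vectors refines the order on leading
positions, and the two agree as soon as the leading positions are distinct.
\<close>

lemma vec_less_iff:
  assumes "f \<in> carrier_vec n" "f \<noteq> 0\<^sub>v n" "g \<in> carrier_vec n" "g \<noteq> 0\<^sub>v n"
  shows "vec_less f g \<longleftrightarrow> lead_pos f < lead_pos g \<or>
     (lead_pos f = lead_pos g \<and> \<bar>lead_coefficient f\<bar> < \<bar>lead_coefficient g\<bar>)"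
  unfolding vec_less_def lead_monomial_eq[OF assms(1,2)] lead_monomial_eq[OF assms(3,4)]
  by (auto simp: less_prod_def prod_eq_iff)

text \<open>
A nonzero monomial that is a multiple of another one determines the factor, because \<open>\<int>\<close> has no zero
divisors: comparing coefficients forces all but one coefficient of \<open>p\<close> to vanish.  Hence reduction
steps only ever subtract monomial multiples.
\<close>

lemma monomial_eq_mult_LT_iff:
  assumes g: "g \<in> carrier_vec n" "g \<noteq> 0\<^sub>v n" and P: "fst P < n" and a: "a \<noteq> 0"
  shows "monomial_vec n (a, snd P, fst P) = p \<cdot>\<^sub>v LT g \<longleftrightarrow>
     lead_divides g a P \<and>
     p = monom (a div lead_coefficient g) (snd P - snd (lead_pos g))"
proof -
  define b d j where "b = lead_coefficient g" and "d = snd (lead_pos g)" and "j = fst (lead_pos g)"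
  obtain i k where ik: "P = (i, k)" by (cases P)
  have b: "b \<noteq> 0" and j: "j < n"
    unfolding b_def j_def using g lead_coefficient_nonzero fst_lead_pos_less by blast+
  have L: "LT g = monom b d \<cdot>\<^sub>v unit_vec n j"
    unfolding b_def d_def j_def by (rule LT_eq[OF g])
  have eq: "monomial_vec n (a, snd P, fst P) = p \<cdot>\<^sub>v LT g \<longleftrightarrow>
      i = j \<and> monom a k = p * monom b d" (is "?l \<longleftrightarrow> ?r")
  proof
    assume ?l
    then have "(monom a k \<cdot>\<^sub>v unit_vec n i) $ i = (p \<cdot>\<^sub>v (monom b d \<cdot>\<^sub>v unit_vec n j)) $ i"
      unfolding L ik by simp
    then have "monom a k = p * (monom b d * (if i = j then 1 else 0))"
      using P j ik by (simp add: unit_vec_def)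
    then show ?r using a by (auto split: if_splits)
  next
    assume ?r
    then show ?l unfolding L ik by (simp add: smult_smult_assoc)
  qed
  have "monom a k = p * monom b d \<longleftrightarrow> d \<le> k \<and> b dvd a \<and> p = monom (a div b) (k - d)"
    (is "?l \<longleftrightarrow> ?r")
  proof
    assume ?l
    then have "monom a k = monom b d * p" by (simp add: mult.commute)
    then have c: "coeff (monom a k) m = (if d \<le> m then b * coeff p (m - d) else 0)" for m
      by (simp only: coeff_monom_mult) auto
    have dk: "d \<le> k" "a = b * coeff p (k - d)" using c[of k] a by (auto split: if_splits)
    moreover have "coeff p e = coeff (monom (a div b) (k - d)) e" for e
      using c[of "e + d"] dk b by (auto split: if_splits)
    ultimately show ?r using dvdI[of a b] by (blast intro: poly_eqI)
  next
    assume ?r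
    then show ?l by (simp add: mult_monom)
  qed
  then show ?thesis unfolding eq unfolding lead_divides_def ik b_def d_def j_def by auto
qed

lemma multiple_of_LT_iff:
  assumes "g \<in> carrier_vec n" "g \<noteq> 0\<^sub>v n" "fst P < n" "a \<noteq> 0"
  shows "multiple_of (monomial_vec n (a, snd P, fst P)) (LT g) \<longleftrightarrow> lead_divides g a P"
  unfolding multiple_of_def monomial_eq_mult_LT_iff[OF assms] by blast

lemma LT_multiple_of_LT_iff:
  assumes "f \<in> carrier_vec n" "f \<noteq> 0\<^sub>v n" "g \<in> carrier_vec n" "g \<noteq> 0\<^sub>v n"
  shows "multiple_of (LT f) (LT g) \<longleftrightarrow> lead_divides g (lead_coefficient f) (lead_pos f)"
  using multiple_of_LT_iff[OF assms(3,4) fst_lead_pos_less lead_coefficient_nonzero] assms(1,2)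
  by (simp add: LT_eq[OF assms(1,2)])

lemma LTs_carrier: "G \<subseteq> carrier_vec n \<Longrightarrow> LTs G = LT ` (G - {0\<^sub>v n})"
  unfolding LTs_def by (rule arg_cong[where f = "image LT"]) auto

lemma LT_carrier: "f \<in> carrier_vec n \<Longrightarrow> f \<noteq> 0\<^sub>v n \<Longrightarrow> LT f \<in> carrier_vec n"
  by (simp add: LT_eq)

lemma LTs_in_carrier: "G \<subseteq> carrier_vec n \<Longrightarrow> LTs G \<subseteq> carrier_vec n"
  by (simp add: LTs_carrier) (blast intro: LT_carrier)

lemma G_reduced_iff:
  assumes "f \<in> carrier_vec n" "G \<subseteq> carrier_vec n" "0\<^sub>v n \<notin> G"
  shows "G_reduced G f \<longleftrightarrow> (\<forall>P\<in>support f. \<forall>g\<in>G. \<not> lead_divides g (coeff_at f P) P)"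
proof -
  have "multiple_of (monomial_vec (dim_vec f) (coeff_at f P, snd P, fst P)) (LT g) \<longleftrightarrow>
      lead_divides g (coeff_at f P) P" if "P \<in> support f" "g \<in> G" for P g
  proof -
    have "g \<in> carrier_vec n" "g \<noteq> 0\<^sub>v n" using that assms by auto
    then show ?thesis
      using multiple_of_LT_iff[of g n P "coeff_at f P"] that assms by (auto simp: in_support_iff)
  qed
  moreover have "G - {0\<^sub>v n} = G" using assms by auto
  ultimately show ?thesis
    unfolding G_reduced_def monomials_eq LTs_carrier[OF assms(2)] by auto
qed

lemma reduction_step_iff:
  assumes f: "f \<in> carrier_vec n" and G: "G \<subseteq> carrier_vec n" "0\<^sub>v n \<notin> G"
  shows "reduction_step G f h \<longleftrightarrow>
    (\<exists>g\<in>G. \<exists>P\<in>support f. lead_divides g (coeff_at f P) P \<and>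
      h = f - monom (coeff_at f P div lead_coefficient g) (snd P - snd (lead_pos g)) \<cdot>\<^sub>v g)"
proof -
  have "(g \<noteq> 0\<^sub>v (dim_vec g) \<and>
      monomial_vec (dim_vec f) (coeff_at f P, snd P, fst P) = p \<cdot>\<^sub>v LT g \<and> h = f - p \<cdot>\<^sub>v g) \<longleftrightarrow>
    (lead_divides g (coeff_at f P) P \<and>
      p = monom (coeff_at f P div lead_coefficient g) (snd P - snd (lead_pos g)) \<and>
      h = f - p \<cdot>\<^sub>v g)" if "g \<in> G" "P \<in> support f" for g P p
  proof -
    have "g \<in> carrier_vec n" "g \<noteq> 0\<^sub>v n" "fst P < n" "coeff_at f P \<noteq> 0"
      using that f G by (auto simp: in_support_iff)
    then show ?thesis using monomial_eq_mult_LT_iff[of g n P "coeff_at f P" p] f by auto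
  qed
  then have "(\<exists>g\<in>G. \<exists>P\<in>support f. \<exists>p. g \<noteq> 0\<^sub>v (dim_vec g) \<and>
      monomial_vec (dim_vec f) (coeff_at f P, snd P, fst P) = p \<cdot>\<^sub>v LT g \<and> h = f - p \<cdot>\<^sub>v g) \<longleftrightarrow>
    (\<exists>g\<in>G. \<exists>P\<in>support f. \<exists>p. lead_divides g (coeff_at f P) P \<and>
      p = monom (coeff_at f P div lead_coefficient g) (snd P - snd (lead_pos g)) \<and>
      h = f - p \<cdot>\<^sub>v g)"
    by (intro bex_cong refl ex_cong1)
  then show ?thesis unfolding reduction_step_def monomials_eq by simp
qed

section \<open>Monomial multiples of vectors\<close>

lemma coeff_at_add:
  "f \<in> carrier_vec n \<Longrightarrow> g \<in> carrier_vec n \<Longrightarrow> fst P < n \<Longrightarrow>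
   coeff_at (f + g) P = coeff_at f P + coeff_at g P"
  by (simp add: coeff_at_def)

lemma coeff_at_diff:
  "f \<in> carrier_vec n \<Longrightarrow> g \<in> carrier_vec n \<Longrightarrow> fst P < n \<Longrightarrow>
   coeff_at (f - g) P = coeff_at f P - coeff_at g P"
  by (simp add: coeff_at_def)

lemma coeff_at_monom_smult:
  "g \<in> carrier_vec n \<Longrightarrow> fst P < n \<Longrightarrow>
   coeff_at (monom q e \<cdot>\<^sub>v g) P =
     (if e \<le> snd P then q * coeff_at g (fst P, snd P - e) else 0)"
  by (simp add: coeff_at_def coeff_monom_mult)

lemma support_monom_smult_le:
  assumes g: "g \<in> carrier_vec n" and P: "P \<in> support (monom q e \<cdot>\<^sub>v g)"
  shows "P \<le> (fst (lead_pos g), snd (lead_pos g) + e)"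
proof -
  have "fst P < n" using P g by (simp add: in_support_iff)
  then have "e \<le> snd P" "(fst P, snd P - e) \<in> support g"
    using P g by (auto simp: in_support_iff coeff_at_monom_smult split: if_splits)
  with le_lead_pos[OF this(2)] show ?thesis by (auto simp: less_eq_prod_def)
qed

lemma lead_coeff_monom_smult:
  assumes g: "g \<in> carrier_vec n" "g \<noteq> 0\<^sub>v n"
  shows "coeff_at (monom q e \<cdot>\<^sub>v g) (fst (lead_pos g), snd (lead_pos g) + e)
     = q * lead_coefficient g"
  using fst_lead_pos_less[OF g] g by (simp add: coeff_at_monom_smult)

lemma lead_monom_smult:
  assumes g: "g \<in> carrier_vec n" "g \<noteq> 0\<^sub>v n" and q: "q \<noteq> 0"
  shows "lead_pos (monom q e \<cdot>\<^sub>v g) = (fst (lead_pos g), snd (lead_pos g) + e)" (is "_ = ?P")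
    and "lead_coefficient (monom q e \<cdot>\<^sub>v g) = q * lead_coefficient g"
    and "monom q e \<cdot>\<^sub>v g \<noteq> 0\<^sub>v n"
proof -
  have P: "?P \<in> support (monom q e \<cdot>\<^sub>v g)"
    using fst_lead_pos_less[OF g] lead_coefficient_nonzero[OF g] g q
    by (simp add: in_support_iff lead_coeff_monom_smult[OF g])
  show *: "lead_pos (monom q e \<cdot>\<^sub>v g) = ?P"
    by (rule lead_pos_eqI[OF P]) (rule support_monom_smult_le[OF g(1)])
  show "lead_coefficient (monom q e \<cdot>\<^sub>v g) = q * lead_coefficient g"
    unfolding * by (rule lead_coeff_monom_smult[OF g])
  show "monom q e \<cdot>\<^sub>v g \<noteq> 0\<^sub>v n" using P by auto
qed

lemma support_add_subset: 
  "f \<in> carrier_vec n \<Longrightarrow> g \<in> carrier_vec n \<Longrightarrow> support (f + g) \<subseteq> support f \<union> support g"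
  by (auto simp: support_def)

lemma support_diff_subset: 
  "f \<in> carrier_vec n \<Longrightarrow> g \<in> carrier_vec n \<Longrightarrow> support (f - g) \<subseteq> support f \<union> support g"
  by (auto simp: support_def)

section \<open>Generated submodules\<close>

lemma smult_zero_vec_right [simp]: "(p :: 'a :: mult_zero) \<cdot>\<^sub>v 0\<^sub>v n = 0\<^sub>v n"
  by (intro eq_vecI) auto

lemma span_in_carrier: 
  assumes "F \<subseteq> carrier_vec n" shows "module_span n F \<subseteq> carrier_vec n"
proof -
  interpret vec_module "TYPE(int poly)" n .
  show ?thesis using span_is_subset2[of F] assms by simp
qed

lemma subset_span: 
  assumes "F \<subseteq> carrier_vec n" shows "F \<subseteq> module_span n F"
proof -
  interpret vec_module "TYPE(int poly)" n .
  show ?thesis using in_own_span[of F] assms by simp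
qed

lemma smult_in_module_span:
  assumes "F \<subseteq> carrier_vec n" "v \<in> module_span n F" shows "p \<cdot>\<^sub>v v \<in> module_span n F"
proof -
  interpret vec_module "TYPE(int poly)" n .
  interpret S: submodule class_ring "span F" V using span_is_submodule[of F] assms(1) by simp
  show ?thesis using S.smult_closed[of p v] assms(2) by (simp add: module_vec_simps)
qed

lemma add_in_module_span:
  assumes "F \<subseteq> carrier_vec n" "u \<in> module_span n F" "v \<in> module_span n F"
  shows "u + v \<in> module_span n F"
proof -
  interpret vec_module "TYPE(int poly)" n .
  interpret S: submodule class_ring "span F" V using span_is_submodule[of F] assms(1) by simp
  show ?thesis using S.m_closed[of u v] assms(2,3) by (simp add: module_vec_simps)
qed

lemma diff_in_module_span:
  assumes F: "F \<subseteq> carrier_vec n" and u: "u \<in> module_span n F" and v: "v \<in> module_span n F"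
  shows "u - v \<in> module_span n F"
proof -
  have "u - v = u + (-1) \<cdot>\<^sub>v v"
    using span_in_carrier[OF F] u v by (intro eq_vecI) auto
  then show ?thesis using add_in_module_span[OF F u smult_in_module_span[OF F v]] by simp
qed

lemma span_least:
  assumes F: "F \<subseteq> carrier_vec n" and N: "F \<subseteq> N" "N \<subseteq> carrier_vec n" "0\<^sub>v n \<in> N"
    and add: "\<And>u v. u \<in> N \<Longrightarrow> v \<in> N \<Longrightarrow> u + v \<in> N"
    and smult: "\<And>p v. v \<in> N \<Longrightarrow> p \<cdot>\<^sub>v v \<in> N"
  shows "module_span n F \<subseteq> N"
proof -
  interpret vec_module "TYPE(int poly)" n .
  have "submodule class_ring N V"
    using N add smult by (intro submodule.intro) (auto simp: module_axioms module_vec_simps)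
  then show ?thesis using span_is_subset[of F N] N(1) by simp
qed

lemma module_span_subset:
  assumes "F \<subseteq> module_span n G" "G \<subseteq> carrier_vec n"
  shows "module_span n F \<subseteq> module_span n G"
proof -
  interpret vec_module "TYPE(int poly)" n .
  show ?thesis using span_is_subset[of F "span G"] span_is_submodule[of G] assms by simp
qed

section \<open>Integer combinations of vectors with distinct leading positions\<close>

locale lead_family =
  fixes n :: nat and b :: "nat \<times> nat \<Rightarrow> int poly vec" and D :: "(nat \<times> nat) set"
  assumes family_carrier: "P \<in> D \<Longrightarrow> b P \<in> carrier_vec n"
    and family_nonzero: "P \<in> D \<Longrightarrow> b P \<noteq> 0\<^sub>v n"
    and family_lead_pos: "P \<in> D \<Longrightarrow> lead_pos (b P) = P"
begin

text \<open>
This is the \<open>\<int>\<close>-span of the family, built by adding summands in increasing order of their leading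
positions, so that the last nonzero summand determines the leading term.  The scalar \<open>z\<close> may be \<open>0\<close>:
then two sums with cancelling summands at the same position add up to a sum of the same form.
\<close>

inductive_set echelon_sums :: "int poly vec set" where
  zero: "0\<^sub>v n \<in> echelon_sums"
| step: "f \<in> echelon_sums \<Longrightarrow> P \<in> D \<Longrightarrow> (\<And>Q. Q \<in> support f \<Longrightarrow> Q < P) \<Longrightarrow>
     monom z 0 \<cdot>\<^sub>v b P + f \<in> echelon_sums"

lemma echelon_sums_carrier: "f \<in> echelon_sums \<Longrightarrow> f \<in> carrier_vec n"
  by (induction rule: echelon_sums.induct) (auto simp: family_carrier)

lemma support_summand_le: "P \<in> D \<Longrightarrow> Q \<in> support (monom z 0 \<cdot>\<^sub>v b P) \<Longrightarrow> Q \<le> P"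
  using support_monom_smult_le[of "b P" n Q z 0] by (simp add: family_carrier family_lead_pos)

text \<open>
Insertion of a summand at its place among the positions, as in insertion sort.  Closure under addition
follows, so the ordered sums exhaust the \<open>\<int>\<close>-span.
\<close>

lemma summand_add_in_echelon_sums:
  assumes "f \<in> echelon_sums" "P \<in> D"
  shows "monom z 0 \<cdot>\<^sub>v b P + f \<in> echelon_sums"
  using assms(1)
proof induction
  case zero
  show ?case by (rule echelon_sums.step) (auto simp: assms echelon_sums.zero)
next
  case (step f Q w)
  note carr = family_carrier[OF assms(2)] family_carrier[OF step.hyps(2)]
    echelon_sums_carrier[OF step.hyps(1)]
  consider "P < Q" | "P = Q" | "Q < P" by fastforce
  then show ?case
  proof cases
    case 1
    have "monom z 0 \<cdot>\<^sub>v b P + (monom w 0 \<cdot>\<^sub>v b Q + f) = monom w 0 \<cdot>\<^sub>v b Q + (monom z 0 \<cdot>\<^sub>v b P + f)"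
      using carr by (intro eq_vecI) auto
    moreover have "R < Q" if "R \<in> support (monom z 0 \<cdot>\<^sub>v b P + f)" for R
      using that support_add_subset[of "monom z 0 \<cdot>\<^sub>v b P" n f] carr
        support_summand_le[OF assms(2), of R z] step.hyps(3)[of R] 1 by fastforce
    ultimately show ?thesis using echelon_sums.step[OF step.IH step.hyps(2)] by simp
  next
    case 2
    have "monom z 0 \<cdot>\<^sub>v b P + (monom w 0 \<cdot>\<^sub>v b Q + f) = monom (z + w) 0 \<cdot>\<^sub>v b Q + f"
      using carr unfolding 2 add_monom[symmetric]
      by (intro eq_vecI) (auto simp: algebra_simps)
    then show ?thesis using echelon_sums.step[OF step.hyps] by simp
  next
    case 3
    have less: "R < P" if "R \<in> support (monom w 0 \<cdot>\<^sub>v b Q + f)" for R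
      using that support_add_subset[of "monom w 0 \<cdot>\<^sub>v b Q" n f] carr
        support_summand_le[OF step.hyps(2), of R w] step.hyps(3)[of R] 3 by fastforce
    show ?thesis
      by (rule echelon_sums.step[OF echelon_sums.step[OF step.hyps] assms(2)]) (auto intro: less)
  qed
qed

lemma add_in_echelon_sums:
  assumes "f \<in> echelon_sums" "g \<in> echelon_sums" shows "f + g \<in> echelon_sums"
  using assms(1)
proof induction
  case zero
  then show ?case using assms(2) echelon_sums_carrier by simp
next
  case (step f P z)
  have "monom z 0 \<cdot>\<^sub>v b P + f + g = monom z 0 \<cdot>\<^sub>v b P + (f + g)"
    using echelon_sums_carrier[OF step.hyps(1)] echelon_sums_carrier[OF assms(2)]
      family_carrier[OF step.hyps(2)] by (intro eq_vecI) auto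
  then show ?case using summand_add_in_echelon_sums[OF step.IH step.hyps(2)] by simp
qed

lemma summand_in_echelon_sums: "P \<in> D \<Longrightarrow> monom z 0 \<cdot>\<^sub>v b P \<in> echelon_sums"
  using summand_add_in_echelon_sums[OF echelon_sums.zero, of P z] family_carrier by simp

lemma lead_of_echelon_sum:
  assumes "f \<in> echelon_sums" "f \<noteq> 0\<^sub>v n"
  shows "lead_pos f \<in> D \<and> lead_coefficient (b (lead_pos f)) dvd lead_coefficient f"
  using assms
proof induction
  case (step f P z)
  note f = echelon_sums_carrier[OF step.hyps(1)]
  note P = family_carrier[OF step.hyps(2)] family_nonzero[OF step.hyps(2)]
  show ?case
  proof (cases "z = 0")
    case True
    then have "monom z 0 \<cdot>\<^sub>v b P + f = f" using f P by (intro eq_vecI) auto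
    then show ?thesis using step.IH step.prems by simp
  next
    case False
    have n: "fst P < n" using fst_lead_pos_less[OF P] family_lead_pos[OF step.hyps(2)] by simp
    have "P \<notin> support f" using step.hyps(3) by blast
    then have "coeff_at f P = 0" using f n by (simp add: in_support_iff)
    then have c: "coeff_at (monom z 0 \<cdot>\<^sub>v b P + f) P = z * coeff_at (b P) P"
      using f P n by (simp add: coeff_at_add coeff_at_monom_smult)
    have "coeff_at (b P) P \<noteq> 0"
      using lead_coefficient_nonzero[OF P] family_lead_pos[OF step.hyps(2)] by simp
    then have "P \<in> support (monom z 0 \<cdot>\<^sub>v b P + f)"
      using c f n False by (simp add: in_support_iff)
    moreover have "R \<le> P" if "R \<in> support (monom z 0 \<cdot>\<^sub>v b P + f)" for R
      using that support_add_subset[of "monom z 0 \<cdot>\<^sub>v b P" n f] f P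
        support_summand_le[OF step.hyps(2), of R z] step.hyps(3)[of R] by fastforce
    ultimately have "lead_pos (monom z 0 \<cdot>\<^sub>v b P + f) = P" by (rule lead_pos_eqI)
    then show ?thesis using step.hyps(2) c family_lead_pos[OF step.hyps(2)] by simp
  qed
qed simp

end

section \<open>S-vectors inside a row generate all relations\<close>

definition S_vector :: "int poly vec \<Rightarrow> int poly vec \<Rightarrow> int poly vec" where
  "S_vector c c' = monom 1 (snd (lead_pos c') - snd (lead_pos c)) \<cdot>\<^sub>v c
     - [:lead_coefficient c div lead_coefficient c':] \<cdot>\<^sub>v c'"

text \<open>
The first three conditions on a generalized Hermite normal form, stated for a set of vectors without
reference to a numbering of the columns.  Two vectors with leading monomials in the same row belong to
the same block, and the order of their leading degrees is the order of the columns.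
\<close>

definition hermite_pairs :: "int poly vec set \<Rightarrow> bool" where
  "hermite_pairs C \<longleftrightarrow> (\<forall>c\<in>C. \<forall>c'\<in>C. c \<noteq> c' \<longrightarrow> fst (lead_pos c) = fst (lead_pos c') \<longrightarrow>
     snd (lead_pos c) \<le> snd (lead_pos c') \<longrightarrow>
     snd (lead_pos c) < snd (lead_pos c') \<and> lead_coefficient c' dvd lead_coefficient c \<and>
     reduces_to_zero C (S_vector c c'))"

text \<open>
Undoing the reduction steps expresses \<open>f\<close> as the sum of the last vector and of monomial multiples of
elements of \<open>C\<close>.  A step cancels a monomial that is present, so the multiple that it subtracts has its
leading position in the support; thus all multiples stay below any bound \<open>R\<close> on the support of \<open>f\<close>.
So \<open>f\<close> lies in every additively closed set that contains these multiples and the last vector.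
\<close>

lemma reduction_steps_backwards:
  assumes steps: "(reduction_step C)\<^sup>*\<^sup>* f h" and C: "C \<subseteq> carrier_vec n" "0\<^sub>v n \<notin> C"
    and f: "f \<in> carrier_vec n" "\<And>Q. Q \<in> support f \<Longrightarrow> Q < R"
    and add: "\<And>u v. u \<in> T \<Longrightarrow> v \<in> T \<Longrightarrow> u + v \<in> T"
    and gen: "\<And>g q e. g \<in> C \<Longrightarrow> (fst (lead_pos g), snd (lead_pos g) + e) < R \<Longrightarrow>
      monom q e \<cdot>\<^sub>v g \<in> T"
    and h: "h \<in> T"
  shows "f \<in> T"
  using steps f
proof (induction rule: converse_rtranclp_induct)
  case base
  show ?case by (rule h)
next
  case (step f f')
  note f = step.prems(1)
  from step.hyps(1) obtain g P where g: "g \<in> C" and P: "P \<in> support f"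
    and div: "lead_divides g (coeff_at f P) P"
    and f': "f' = f - monom (coeff_at f P div lead_coefficient g) (snd P - snd (lead_pos g)) \<cdot>\<^sub>v g"
    unfolding reduction_step_iff[OF f C] by blast
  define q e where "q = coeff_at f P div lead_coefficient g" and "e = snd P - snd (lead_pos g)"
  have P_eq: "(fst (lead_pos g), snd (lead_pos g) + e) = P"
    using div unfolding lead_divides_def e_def by (simp add: prod_eq_iff)
  have gc: "g \<in> carrier_vec n" using g C by blast
  have f': "f' = f - monom q e \<cdot>\<^sub>v g" using f' unfolding q_def e_def .
  have "P < R" using P by (rule step.prems(2))
  then have "Q \<in> support (monom q e \<cdot>\<^sub>v g) \<Longrightarrow> Q < R" for Q
    using support_monom_smult_le[OF gc, of Q q e] unfolding P_eq by simp
  moreover have "support f' \<subseteq> support f \<union> support (monom q e \<cdot>\<^sub>v g)"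
    unfolding f' using f gc by (intro support_diff_subset) auto
  ultimately have "Q < R" if "Q \<in> support f'" for Q
    using that step.prems(2)[of Q] by blast
  then have "f' \<in> T" using step.IH f gc f' by simp
  moreover have "monom q e \<cdot>\<^sub>v g \<in> T"
    by (rule gen[OF g]) (simp add: P_eq \<open>P < R\<close>)
  ultimately have "f' + monom q e \<cdot>\<^sub>v g \<in> T" by (rule add)
  moreover have "f' + monom q e \<cdot>\<^sub>v g = f" unfolding f' using f gc by (intro eq_vecI) auto
  ultimately show ?case by simp
qed

text \<open>
The two summands of the S-vector have the same leading monomial, which cancels.
\<close>

lemma S_vector_support:
  assumes c: "c \<in> carrier_vec n" "c \<noteq> 0\<^sub>v n" and c': "c' \<in> carrier_vec n" "c' \<noteq> 0\<^sub>v n"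
    and row: "fst (lead_pos c) = fst (lead_pos c')" and deg: "snd (lead_pos c) \<le> snd (lead_pos c')"
    and dvd: "lead_coefficient c' dvd lead_coefficient c" and Q: "Q \<in> support (S_vector c c')"
  shows "Q < lead_pos c'"
proof -
  let ?u = "monom 1 (snd (lead_pos c') - snd (lead_pos c)) \<cdot>\<^sub>v c"
  let ?v = "monom (lead_coefficient c div lead_coefficient c') 0 \<cdot>\<^sub>v c'"
  have S: "S_vector c c' = ?u - ?v" unfolding S_vector_def monom_0 ..
  have lp: "(fst (lead_pos c), snd (lead_pos c) + (snd (lead_pos c') - snd (lead_pos c))) = lead_pos c'"
    using row deg by (intro prod_eqI) auto
  have "coeff_at ?u (lead_pos c') = lead_coefficient c"
    using lead_coeff_monom_smult[OF c, of 1 "snd (lead_pos c') - snd (lead_pos c)"] unfolding lp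
    by simp
  moreover have "coeff_at ?v (lead_pos c') = lead_coefficient c"
    using lead_coeff_monom_smult[OF c', of _ 0] dvd by simp
  moreover have "coeff_at (?u - ?v) (lead_pos c') = coeff_at ?u (lead_pos c') - coeff_at ?v (lead_pos c')"
    using c c' by (intro coeff_at_diff fst_lead_pos_less) auto
  ultimately have "coeff_at (S_vector c c') (lead_pos c') = 0" unfolding S by linarith
  then have "Q \<noteq> lead_pos c'" using Q by (auto simp: in_support_iff)
  moreover have "Q \<in> support ?u \<or> Q \<in> support ?v"
    using Q support_diff_subset[of ?u n ?v] c c' unfolding S by auto
  then have "Q \<le> lead_pos c'"
  proof
    assume "Q \<in> support ?u"
    from support_monom_smult_le[OF c(1) this] show ?thesis unfolding lp .
  next
    assume "Q \<in> support ?v"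
    from support_monom_smult_le[OF c'(1) this] show ?thesis by simp
  qed
  ultimately show ?thesis by simp
qed

text \<open>
The multiples \<open>x\<^sup>e c\<close> with \<open>c\<close> of maximal leading degree for each reachable position form a
\<open>\<int>\<close>-basis of the module: the S-vectors rewrite every other multiple \<open>x\<^sup>e c\<close> as an integer multiple of
the chosen one plus multiples at smaller positions.
\<close>

lemma hermite_pairs_lead_divides:
  assumes fin: "finite C" and C: "C \<subseteq> carrier_vec n" "0\<^sub>v n \<notin> C" and pairs: "hermite_pairs C"
    and f: "f \<in> module_span n C" "f \<noteq> 0\<^sub>v n"
  shows "\<exists>g\<in>C. lead_divides g (lead_coefficient f) (lead_pos f)"
proof -
  let ?row = "\<lambda>c. fst (lead_pos c)" and ?deg = "\<lambda>c. snd (lead_pos c)"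
  \<comment> \<open>\<open>D\<close> is the set of leading positions of the multiples \<open>x\<^sup>e c\<close>; among the vectors of \<open>C\<close>
    that reach the position, \<open>top P\<close> has the largest leading degree.\<close>
  define D where "D = {P. \<exists>c\<in>C. ?row c = fst P \<and> ?deg c \<le> snd P}"
  define best where "best P c \<longleftrightarrow> c \<in> C \<and> ?row c = fst P \<and> ?deg c \<le> snd P \<and>
      (\<forall>c'\<in>C. ?row c' = fst P \<longrightarrow> ?deg c' \<le> snd P \<longrightarrow> ?deg c' \<le> ?deg c)" for P c
  define top where "top P = (SOME c. best P c)" for P
  have "\<exists>c. best P c" if "P \<in> D" for P
  proof -
    let ?X = "{c \<in> C. ?row c = fst P \<and> ?deg c \<le> snd P}"
    have X: "finite (?deg ` ?X)" "?deg ` ?X \<noteq> {}" using fin that unfolding D_def by auto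
    from Max_in[OF X] obtain c where c: "c \<in> ?X" "?deg c = Max (?deg ` ?X)" by force
    have "?deg c' \<le> ?deg c" if "c' \<in> ?X" for c'
      unfolding c(2) using X(1) that by (intro Max_ge) auto
    then show ?thesis using c(1) unfolding best_def by blast
  qed
  then have "best P (top P)" if "P \<in> D" for P
    using that unfolding top_def by (blast intro: someI_ex)
  then have top: "top P \<in> C" "?row (top P) = fst P" "?deg (top P) \<le> snd P"
      "\<And>c. c \<in> C \<Longrightarrow> ?row c = fst P \<Longrightarrow> ?deg c \<le> snd P \<Longrightarrow> ?deg c \<le> ?deg (top P)"
    if "P \<in> D" for P
    using that unfolding best_def by blast+
  define b where "b P = monom 1 (snd P - ?deg (top P)) \<cdot>\<^sub>v top P" for P
  have topC: "top P \<in> carrier_vec n" "top P \<noteq> 0\<^sub>v n" if "P \<in> D" for P using top(1)[OF that] C by auto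
  interpret lead_family n b D
  proof
    fix P assume P: "P \<in> D"
    show "b P \<in> carrier_vec n" unfolding b_def using topC[OF P] by simp
    show "b P \<noteq> 0\<^sub>v n" unfolding b_def using lead_monom_smult(3)[OF topC[OF P]] by simp
    show "lead_pos (b P) = P" unfolding b_def
      using lead_monom_smult(1)[OF topC[OF P], of 1 "snd P - ?deg (top P)"] top(2,3)[OF P]
      by (auto intro: prod_eqI)
  qed
  have monom_multiples: "monom q e \<cdot>\<^sub>v c \<in> echelon_sums" if "c \<in> C" for c q e
    using that
  proof (induction "(?row c, ?deg c + e)" arbitrary: c q e rule: less_induct)
    case less
    define P where "P = (?row c, ?deg c + e)"
    have P: "P \<in> D" unfolding P_def D_def using less.prems by auto
    define c' where "c' = top P"
    have c: "c \<in> carrier_vec n" "c \<noteq> 0\<^sub>v n" using less.prems C by auto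
    have c'C: "c' \<in> C" and c': "c' \<in> carrier_vec n" "c' \<noteq> 0\<^sub>v n"
      using top(1)[OF P] C unfolding c'_def by auto
    have row: "?row c = ?row c'" and deg: "?deg c \<le> ?deg c'" and deg': "?deg c' \<le> ?deg c + e"
      using top(2,3)[OF P] top(4)[OF P less.prems] unfolding c'_def by (auto simp: P_def)
    define e' where "e' = ?deg c + e - ?deg c'"
    have bP: "b P = monom 1 e' \<cdot>\<^sub>v c'" unfolding b_def e'_def c'_def by (simp add: P_def)
    have c'_sum: "monom q e' \<cdot>\<^sub>v c' \<in> echelon_sums" for q
      using summand_in_echelon_sums[OF P, of q] unfolding bP by (simp add: smult_smult_assoc mult_monom)
    show ?case
    proof (cases "c = c'")
      case True
      then have "e = e'" unfolding e'_def by simp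
      then show ?thesis using c'_sum True by simp
    next
      case False
      with pairs less.prems c'C row deg have dvd: "lead_coefficient c' dvd lead_coefficient c"
        and zero: "reduces_to_zero C (S_vector c c')"
        unfolding hermite_pairs_def by blast+
      let ?S = "S_vector c c'"
      have S: "?S \<in> carrier_vec n" unfolding S_vector_def using c c' by simp
      \<comment> \<open>Multiplying the reduction of the S-vector by \<open>q x\<^bsup>e'\<^esup>\<close> shifts all positions by \<open>e'\<close>, which
        moves the bound \<open>lead_pos c'\<close> to \<open>P\<close>, where the induction hypothesis applies.\<close>
      have "?S \<in> {v \<in> carrier_vec n. monom q e' \<cdot>\<^sub>v v \<in> echelon_sums}" (is "_ \<in> ?T")
      proof (rule reduction_steps_backwards[OF _ C S])
        show "(reduction_step C)\<^sup>*\<^sup>* ?S (0\<^sub>v n)"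
          using zero S unfolding reduces_to_zero_def normal_form_def by simp
        show "Q < lead_pos c'" if "Q \<in> support ?S" for Q
          by (rule S_vector_support[OF c c' row deg dvd that])
        show "u + v \<in> ?T" if "u \<in> ?T" "v \<in> ?T" for u v
          using that add_in_echelon_sums by (auto simp: smult_add_distrib_vec)
        show "monom q2 e2 \<cdot>\<^sub>v g \<in> ?T" if g: "g \<in> C" and "(?row g, ?deg g + e2) < lead_pos c'" for g q2 e2
        proof -
          have "(?row g, ?deg g + (e' + e2)) < (?row c, ?deg c + e)"
            using that(2) row deg' unfolding e'_def by (auto simp: less_prod_def)
          from less.hyps[OF this g] show ?thesis
            using g C by (auto simp: smult_smult_assoc mult_monom)
        qed
        show "0\<^sub>v n \<in> ?T" using echelon_sums.zero by simp
      qed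
      then have "monom q e' \<cdot>\<^sub>v ?S \<in> echelon_sums" by blast
      from add_in_echelon_sums[OF this c'_sum[of "q * (lead_coefficient c div lead_coefficient c')"]]
      have "monom q e' \<cdot>\<^sub>v ?S + monom (q * (lead_coefficient c div lead_coefficient c')) e' \<cdot>\<^sub>v c'
        \<in> echelon_sums" .
      moreover have "monom q e' \<cdot>\<^sub>v ?S + monom (q * (lead_coefficient c div lead_coefficient c')) e' \<cdot>\<^sub>v c'
        = monom q e \<cdot>\<^sub>v c"
      proof -
        have z: "monom (q * z) e' = Polynomial.smult z (monom q e')" for z :: int
          by (simp add: smult_monom mult.commute)
        have "monom q e = monom q e' * monom 1 (?deg c' - ?deg c)"
          unfolding mult_monom using deg deg' unfolding e'_def by simp
        then show ?thesis unfolding S_vector_def z using c c'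
          by (intro eq_vecI) (auto simp: algebra_simps)
      qed
      ultimately show ?thesis by simp
    qed
  qed
  \<comment> \<open>The factor \<open>x\<^sup>e\<close> absorbs the power of \<open>x\<close> that each coefficient step of the induction splits off.\<close>
  have multiples: "monom 1 e * p \<cdot>\<^sub>v c \<in> echelon_sums" if c: "c \<in> C" for c p e
  proof (induction p arbitrary: e)
    case 0
    have "0 \<cdot>\<^sub>v c = 0\<^sub>v n" using c C by (intro eq_vecI) auto
    then show ?case using echelon_sums.zero by simp
  next
    case (pCons a p)
    have "monom 1 e * pCons a p \<cdot>\<^sub>v c = monom a e \<cdot>\<^sub>v c + monom 1 (Suc e) * p \<cdot>\<^sub>v c"
    proof -
      have "monom 1 e * pCons a p = monom a e + monom 1 (Suc e) * p"
        by (simp add: mult_pCons_right monom_Suc smult_monom)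
      then show ?thesis by (simp add: add_smult_distrib_vec)
    qed
    then show ?case using add_in_echelon_sums[OF monom_multiples[OF c] pCons.IH] by simp
  qed
  have poly_multiples: "p \<cdot>\<^sub>v c \<in> echelon_sums" if "c \<in> C" for c p
    using multiples[OF that, of 0 p] by (simp add: monom_eq_1)
  have "p \<cdot>\<^sub>v v \<in> echelon_sums" if "v \<in> echelon_sums" for p v
    using that
  proof induction
    case zero
    show ?case using echelon_sums.zero by simp
  next
    case (step g P z)
    have "p \<cdot>\<^sub>v (monom z 0 \<cdot>\<^sub>v b P + g) = (p * monom z (snd P - ?deg (top P))) \<cdot>\<^sub>v top P + p \<cdot>\<^sub>v g"
      using topC[OF step.hyps(2)] echelon_sums_carrier[OF step.hyps(1)] unfolding b_def
      by (subst smult_add_distrib_vec) (auto simp: smult_smult_assoc mult_monom mult.assoc)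
    then show ?case
      using add_in_echelon_sums[OF poly_multiples[OF top(1)[OF step.hyps(2)]] step.IH] by simp
  qed
  moreover have "C \<subseteq> echelon_sums" using poly_multiples[of _ 1] by auto
  ultimately have "module_span n C \<subseteq> echelon_sums"
    using C(1) echelon_sums.zero echelon_sums_carrier add_in_echelon_sums
    by (intro span_least) auto
  then have "f \<in> echelon_sums" using f(1) by blast
  from lead_of_echelon_sum[OF this f(2)] have P: "lead_pos f \<in> D"
    and dvd: "lead_coefficient (b (lead_pos f)) dvd lead_coefficient f" by auto
  have "lead_coefficient (b (lead_pos f)) = lead_coefficient (top (lead_pos f))"
    unfolding b_def lead_monom_smult(2)[OF topC[OF P] one_neq_zero] by simp
  then have "lead_divides (top (lead_pos f)) (lead_coefficient f) (lead_pos f)"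
    unfolding lead_divides_def using dvd top(2,3)[OF P] by simp
  then show ?thesis using top(1)[OF P] by blast
qed

section \<open>Strong and reduced Groebner bases\<close>

text \<open>
If each leading term of the module is a multiple of a leading term of the basis, then it lies in the
module generated by the latter; as the basis is contained in the module, the two modules generated by
leading terms coincide.
\<close>

lemma strong_groebner_basis_iff:
  assumes F: "finite F" "F \<subseteq> carrier_vec n" "0\<^sub>v n \<notin> F"
  shows "strong_groebner_basis n F \<longleftrightarrow> (\<forall>f \<in> module_span n F. f \<noteq> 0\<^sub>v n \<longrightarrow>
    (\<exists>g\<in>F. lead_divides g (lead_coefficient f) (lead_pos f)))"
proof -
  let ?L = "module_span n F"
  have L: "?L \<subseteq> carrier_vec n" by (rule span_in_carrier[OF F(2)])
  have F0: "F - {0\<^sub>v n} = F" using F by auto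
  have "(\<exists>v\<in>LTs F. multiple_of (LT f) v) \<longleftrightarrow>
      (\<exists>g\<in>F. lead_divides g (lead_coefficient f) (lead_pos f))" if "f \<in> ?L" "f \<noteq> 0\<^sub>v n" for f
  proof -
    have f: "f \<in> carrier_vec n" using that L by blast
    have "multiple_of (LT f) (LT g) \<longleftrightarrow> lead_divides g (lead_coefficient f) (lead_pos f)"
      if "g \<in> F" for g
    proof (rule LT_multiple_of_LT_iff[OF f \<open>f \<noteq> 0\<^sub>v n\<close>])
      show "g \<in> carrier_vec n" "g \<noteq> 0\<^sub>v n" using that F by auto
    qed
    then show ?thesis unfolding LTs_carrier[OF F(2)] F0 by simp
  qed
  then have iff: "(\<forall>u\<in>LTs ?L. \<exists>v\<in>LTs F. multiple_of u v) \<longleftrightarrow>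
    (\<forall>f\<in>?L. f \<noteq> 0\<^sub>v n \<longrightarrow> (\<exists>g\<in>F. lead_divides g (lead_coefficient f) (lead_pos f)))"
    unfolding LTs_carrier[OF L] by auto
  have "groebner_basis n F" if *: "\<forall>u\<in>LTs ?L. \<exists>v\<in>LTs F. multiple_of u v"
  proof -
    have LF: "LTs F \<subseteq> carrier_vec n" and LL: "LTs ?L \<subseteq> carrier_vec n"
      using F(2) L by (simp_all add: LTs_in_carrier)
    have "LTs ?L \<subseteq> module_span n (LTs F)"
    proof
      fix u assume "u \<in> LTs ?L"
      then obtain v p where v: "v \<in> LTs F" and u: "u = p \<cdot>\<^sub>v v"
        using * unfolding multiple_of_def by blast
      from v have "v \<in> module_span n (LTs F)" using subset_span[OF LF] by blast
      then show "u \<in> module_span n (LTs F)" unfolding u by (rule smult_in_module_span[OF LF])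
    qed
    then have "module_span n (LTs ?L) \<subseteq> module_span n (LTs F)"
      using LF by (rule module_span_subset)
    moreover have "LTs F \<subseteq> module_span n (LTs ?L)"
      using subset_span[OF F(2)] subset_span[OF LL] unfolding LTs_carrier[OF F(2)] LTs_carrier[OF L]
      by blast
    then have "module_span n (LTs F) \<subseteq> module_span n (LTs ?L)"
      using LL by (rule module_span_subset)
    ultimately show ?thesis unfolding groebner_basis_def using F by blast
  qed
  then show ?thesis unfolding strong_groebner_basis_def iff[symmetric] by blast
qed

text \<open>
As long as the vector is nonzero, its leading monomial can be cancelled without leaving the module, and
the leading position decreases.  Since positions are well-ordered, this ends at \<open>0\<close>.
\<close>

lemma strong_groebner_basis_reduces_to_zero:
  assumes F: "F \<subseteq> carrier_vec n" "0\<^sub>v n \<notin> F"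
    and div: "\<And>f. f \<in> module_span n F \<Longrightarrow> f \<noteq> 0\<^sub>v n \<Longrightarrow>
      \<exists>g\<in>F. lead_divides g (lead_coefficient f) (lead_pos f)"
    and f: "f \<in> module_span n F"
  shows "reduces_to_zero F f"
proof -
  have L: "module_span n F \<subseteq> carrier_vec n" by (rule span_in_carrier[OF F(1)])
  have "(reduction_step F)\<^sup>*\<^sup>* f (0\<^sub>v n)" using f
  proof (induction "lead_pos f" arbitrary: f rule: less_induct)
    case less
    show ?case
    proof (cases "f = 0\<^sub>v n")
      case False
      have f: "f \<in> carrier_vec n" using less.prems L by blast
      note lp = lead_pos_in_support[OF f False]
      obtain g where g: "g \<in> F" and dvd: "lead_divides g (lead_coefficient f) (lead_pos f)"
        using div[OF less.prems False] by blast
      have gc: "g \<in> carrier_vec n" "g \<noteq> 0\<^sub>v n" using g F by auto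
      define q e where "q = lead_coefficient f div lead_coefficient g"
        and "e = snd (lead_pos f) - snd (lead_pos g)"
      define h where "h = f - monom q e \<cdot>\<^sub>v g"
      have step: "reduction_step F f h"
        unfolding reduction_step_iff[OF f F] h_def q_def e_def using g dvd lp by blast
      have hL: "h \<in> module_span n F" unfolding h_def
        using less.prems g subset_span[OF F(1)] F(1)
        by (intro diff_in_module_span smult_in_module_span) auto
      have P: "(fst (lead_pos g), snd (lead_pos g) + e) = lead_pos f"
        using dvd unfolding lead_divides_def e_def by (intro prod_eqI) auto
      have "coeff_at (monom q e \<cdot>\<^sub>v g) (lead_pos f) = lead_coefficient f"
        using lead_coeff_monom_smult[OF gc, of q e] dvd unfolding P q_def lead_divides_def by simp
      moreover have "coeff_at h (lead_pos f) = lead_coefficient f - coeff_at (monom q e \<cdot>\<^sub>v g) (lead_pos f)"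
        unfolding h_def using f gc False by (intro coeff_at_diff fst_lead_pos_less) auto
      ultimately have "lead_pos f \<notin> support h" by (simp add: in_support_iff)
      moreover have "support h \<subseteq> support f \<union> support (monom q e \<cdot>\<^sub>v g)"
        unfolding h_def using f gc by (intro support_diff_subset) auto
      then have "Q \<le> lead_pos f" if "Q \<in> support h" for Q
        using that le_lead_pos[of Q f] support_monom_smult_le[OF gc(1), of Q q e] unfolding P by blast
      ultimately have less': "Q < lead_pos f" if "Q \<in> support h" for Q
        using that by (metis order_le_less)
      have "(reduction_step F)\<^sup>*\<^sup>* h (0\<^sub>v n)"
      proof (cases "h = 0\<^sub>v n")
        case False
        have "lead_pos h \<in> support h" using hL L False by (intro lead_pos_in_support) auto
        then show ?thesis using less.hyps[OF less' hL] by blast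
      qed simp
      then show ?thesis using step by (rule converse_rtranclp_into_rtranclp[rotated])
    qed simp
  qed
  moreover have "G_reduced F (0\<^sub>v n)" using G_reduced_iff[OF _ F, of "0\<^sub>v n"] by simp
  moreover have "dim_vec f = n" using f L by auto
  ultimately show ?thesis unfolding reduces_to_zero_def normal_form_def by simp
qed

text \<open>
An integer combination of \<open>x\<^bsup>d' - d\<^esup> c\<close> and \<open>c'\<close> realises the gcd of the leading coefficients as a
leading coefficient at the leading position of \<open>c'\<close>.  By minimality of the reduced basis the basis
element dividing that leading term can only be \<open>c'\<close>.
\<close>

lemma strong_reduced_hermite_pairs:
  assumes F: "F \<subseteq> carrier_vec n" "0\<^sub>v n \<notin> F"
    and div: "\<And>f. f \<in> module_span n F \<Longrightarrow> f \<noteq> 0\<^sub>v n \<Longrightarrow>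
      \<exists>g\<in>F. lead_divides g (lead_coefficient f) (lead_pos f)"
    and red: "\<And>f. f \<in> F \<Longrightarrow> G_reduced (F - {f}) f"
  shows "hermite_pairs F"
  unfolding hermite_pairs_def
proof (intro ballI impI)
  fix c c' assume cF: "c \<in> F" "c' \<in> F" and neq: "c \<noteq> c'"
    and row: "fst (lead_pos c) = fst (lead_pos c')"
    and deg: "snd (lead_pos c) \<le> snd (lead_pos c')"
  let ?a = "lead_coefficient c" and ?a' = "lead_coefficient c'"
  have c: "c \<in> carrier_vec n" "c \<noteq> 0\<^sub>v n" and c': "c' \<in> carrier_vec n" "c' \<noteq> 0\<^sub>v n"
    using cF F by auto
  \<comment> \<open>The leading monomial of \<open>f\<close> is one of its monomials, so being G-reduced applies to it.\<close>
  have minimal: "g = f" if "g \<in> F" "f \<in> F" "lead_divides g (lead_coefficient f) (lead_pos f)" for f g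
  proof (rule ccontr)
    assume "g \<noteq> f"
    have f: "f \<in> carrier_vec n" "f \<noteq> 0\<^sub>v n" using that F by auto
    have F': "F - {f} \<subseteq> carrier_vec n" "0\<^sub>v n \<notin> F - {f}" using F by auto
    from red[OF that(2)] lead_pos_in_support[OF f] that(1,3) \<open>g \<noteq> f\<close> show False
      unfolding G_reduced_iff[OF f(1) F'] by blast
  qed
  define e where "e = snd (lead_pos c') - snd (lead_pos c)"
  have lp: "(fst (lead_pos c), snd (lead_pos c) + e) = lead_pos c'"
    using row deg unfolding e_def by (intro prod_eqI) auto
  \<comment> \<open>\<open>w\<close> has the leading term \<open>gcd a a' x\<^bsup>d'\<^esup>\<close> in the row of \<open>c\<close> and \<open>c'\<close>.\<close>
  obtain u v where uv: "u * ?a + v * ?a' = gcd ?a ?a'" using bezout_int by blast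
  let ?w = "monom u e \<cdot>\<^sub>v c + monom v 0 \<cdot>\<^sub>v c'"
  have wL: "?w \<in> module_span n F"
    using cF subset_span[OF F(1)] F(1) by (intro add_in_module_span smult_in_module_span) auto
  have "coeff_at (monom u e \<cdot>\<^sub>v c) (lead_pos c') = u * ?a"
    using lead_coeff_monom_smult[OF c, of u e] unfolding lp .
  moreover have "coeff_at (monom v 0 \<cdot>\<^sub>v c') (lead_pos c') = v * ?a'"
    using lead_coeff_monom_smult[OF c', of v 0] by simp
  moreover have "coeff_at ?w (lead_pos c') =
      coeff_at (monom u e \<cdot>\<^sub>v c) (lead_pos c') + coeff_at (monom v 0 \<cdot>\<^sub>v c') (lead_pos c')"
    using c c' by (intro coeff_at_add fst_lead_pos_less) auto
  ultimately have wc: "coeff_at ?w (lead_pos c') = gcd ?a ?a'" using uv by simp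
  then have "lead_pos c' \<in> support ?w"
    using fst_lead_pos_less[OF c'] lead_coefficient_nonzero[OF c'] c c' by (simp add: in_support_iff)
  moreover have "support ?w \<subseteq> support (monom u e \<cdot>\<^sub>v c) \<union> support (monom v 0 \<cdot>\<^sub>v c')"
    using c c' by (intro support_add_subset) auto
  then have "Q \<le> lead_pos c'" if "Q \<in> support ?w" for Q
    using that support_monom_smult_le[OF c(1), of Q u e] support_monom_smult_le[OF c'(1), of Q v 0]
    unfolding lp by auto
  ultimately have wlp: "lead_pos ?w = lead_pos c'" by (rule lead_pos_eqI)
  have "?w \<noteq> 0\<^sub>v n" using \<open>lead_pos c' \<in> support ?w\<close> by auto
  from div[OF wL this] obtain g where g: "g \<in> F" "lead_divides g (gcd ?a ?a') (lead_pos c')"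
    unfolding wlp wc by blast
  then have "lead_divides g ?a' (lead_pos c')" unfolding lead_divides_def by (auto intro: dvd_trans)
  from minimal[OF g(1) cF(2) this] g(2) have dvd: "?a' dvd ?a" unfolding lead_divides_def by simp
  have less: "snd (lead_pos c) < snd (lead_pos c')"
  proof (rule ccontr)
    assume "\<not> ?thesis"
    then have "lead_divides c' ?a (lead_pos c)" using dvd row unfolding lead_divides_def by simp
    from minimal[OF cF(2,1) this] neq show False by simp
  qed
  have "S_vector c c' \<in> module_span n F" unfolding S_vector_def
    using cF subset_span[OF F(1)] F(1) by (intro diff_in_module_span smult_in_module_span) auto
  then have "reduces_to_zero F (S_vector c c')"
    using strong_groebner_basis_reduces_to_zero[OF F div, of "S_vector c c'"] by simp
  then show "snd (lead_pos c) < snd (lead_pos c') \<and> ?a' dvd ?a \<and> reduces_to_zero F (S_vector c c')"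
    using less dvd by blast
qed

section \<open>Block structure of the columns\<close>

lemma block_index_less:
  fixes l :: "nat \<Rightarrow> nat"
  assumes "i < t" "j < l i"
  shows "(\<Sum>k<i. l k) + j < (\<Sum>k<t. l k)"
proof -
  have "(\<Sum>k<i. l k) + j < (\<Sum>k<Suc i. l k)" using assms(2) by simp
  also have "\<dots> \<le> (\<Sum>k<t. l k)" using assms(1) by (intro sum_mono2) auto
  finally show ?thesis .
qed

lemma block_index_exists:
  fixes l :: "nat \<Rightarrow> nat"
  assumes "m < (\<Sum>k<t. l k)"
  shows "\<exists>i<t. \<exists>j<l i. m = (\<Sum>k<i. l k) + j"
  using assms
proof (induction t)
  case (Suc t)
  show ?case
  proof (cases "m < (\<Sum>k<t. l k)")
    case True
    then show ?thesis using Suc.IH less_SucI by blast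
  next
    case False
    then have "m - (\<Sum>k<t. l k) < l t" "m = (\<Sum>k<t. l k) + (m - (\<Sum>k<t. l k))"
      using Suc.prems by auto
    then show ?thesis by blast
  qed
qed simp

text \<open>
The blocks are the maximal runs of equal entries.  Appending an entry to the list either extends the
last run or opens a new one.
\<close>

lemma sorted_block_decomposition:
  fixes xs :: "nat list"
  assumes "sorted xs"
  shows "\<exists>(t :: nat) r l. (\<forall>i<t. 0 < l i \<and> r i \<in> set xs) \<and> (\<forall>i1 i2. i1 < i2 \<longrightarrow> i2 < t \<longrightarrow> r i1 < r i2) \<and>
    length xs = (\<Sum>i<t. l i) \<and> (\<forall>i<t. \<forall>j<l i. xs ! ((\<Sum>k<i. l k) + j) = r i)"
  using assms
proof (induction xs rule: rev_induct)
  case Nil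
  show ?case by (rule exI[of _ "0 :: nat"]) simp
next
  case (snoc x xs)
  then have le: "\<And>y. y \<in> set xs \<Longrightarrow> y \<le> x" and "sorted xs" by (auto simp: sorted_append)
  from snoc.IH[OF this(2)] obtain t :: nat and r l where
      *: "\<forall>i<t. 0 < l i \<and> r i \<in> set xs" "\<forall>i1 i2. i1 < i2 \<longrightarrow> i2 < t \<longrightarrow> r i1 < r i2"
      and len: "length xs = (\<Sum>i<t. l i)"
      and **: "\<forall>i<t. \<forall>j<l i. xs ! ((\<Sum>k<i. l k) + j) = r i"
    by (elim exE conjE) (rule that)
  have pos: "0 < l i" "r i \<in> set xs" if "i < t" for i using * that by auto
  have mono: "r i1 < r i2" if "i1 < i2" "i2 < t" for i1 i2 using * that by blast
  have nth: "xs ! ((\<Sum>k<i. l k) + j) = r i" if "i < t" "j < l i" for i j using ** that by blast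
  have nth': "(xs @ [x]) ! ((\<Sum>k<i. l k) + j) = r i" if "i < t" "j < l i" for i j
    using nth[OF that] block_index_less[of i t j l, OF that] len by (simp add: nth_append)
  show ?case
  proof (cases "\<exists>i<t. r i = x")
    case True
    then obtain i where i: "i < t" "r i = x" by blast
    have last: "t = Suc i"
    proof (rule ccontr)
      assume "t \<noteq> Suc i"
      then have "Suc i < t" using i by simp
      from mono[OF lessI this] le[OF pos(2)[OF this]] i show False by simp
    qed
    define l' where "l' = l(i := Suc (l i))"
    have sum: "(\<Sum>k<m. l' k) = (\<Sum>k<m. l k)" if "m \<le> i" for m
      using that unfolding l'_def by (intro sum.cong) auto
    show ?thesis
    proof (rule exI[of _ t], rule exI[of _ r], rule exI[of _ l'], intro conjI allI impI)
      show "length (xs @ [x]) = (\<Sum>k<t. l' k)"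
        using sum[of i] len unfolding last by (simp add: l'_def)
      show "(xs @ [x]) ! ((\<Sum>k<k'. l' k) + j) = r k'" if "k' < t" "j < l' k'" for k' j
      proof (cases "k' = i \<and> j = l i")
        case True
        then show ?thesis using sum[of i] len i last by (simp add: nth_append)
      next
        case False
        then have "j < l k'" using that unfolding l'_def by (auto split: if_splits)
        then show ?thesis using nth'[OF that(1)] sum[of k'] that(1) last by simp
      qed
    qed (use pos mono in \<open>auto simp: l'_def\<close>)
  next
    case False
    then have less: "r i < x" if "i < t" for i using le[OF pos(2)[OF that]] that by (simp add: order_le_less)
    define l' r' where "l' = l(t := 1)" and "r' = r(t := x)"
    have sum: "(\<Sum>k<m. l' k) = (\<Sum>k<m. l k)" if "m \<le> t" for m
      using that unfolding l'_def by (intro sum.cong) auto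
    show ?thesis
    proof (rule exI[of _ "Suc t"], rule exI[of _ r'], rule exI[of _ l'], intro conjI allI impI)
      show "length (xs @ [x]) = (\<Sum>k<Suc t. l' k)"
        using sum[of t] len by (simp add: l'_def)
      show "(xs @ [x]) ! ((\<Sum>k<i. l' k) + j) = r' i" if "i < Suc t" "j < l' i" for i j
      proof (cases "i = t")
        case True
        then show ?thesis using sum[of t] len that unfolding l'_def r'_def by (simp add: nth_append)
      next
        case False
        then show ?thesis using nth'[of i j] sum[of i] that unfolding l'_def r'_def by simp
      qed
      show "r' i1 < r' i2" if "i1 < i2" "i2 < Suc t" for i1 i2
        using that less mono unfolding r'_def by (auto simp: less_Suc_eq)
    qed (use pos in \<open>auto simp: l'_def r'_def less_Suc_eq\<close>)
  qed
qed

text \<open>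
In a column of an echelon matrix the leading position can be read off from the pivot entry.
\<close>

lemma lead_pos_pivot:
  assumes f: "f \<in> carrier_vec n" and r: "r < n" "f $ r \<noteq> 0"
    and below: "\<And>k. r < k \<Longrightarrow> k < n \<Longrightarrow> f $ k = 0"
  shows "lead_pos f = (r, degree (f $ r))"
proof (rule lead_pos_eqI)
  show "(r, degree (f $ r)) \<in> support f" using f r by (simp add: support_def)
  show "Q \<le> (r, degree (f $ r))" if "Q \<in> support f" for Q
  proof -
    obtain i k where Q: "Q = (i, k)" by (cases Q)
    then have "i < n" "coeff (f $ i) k \<noteq> 0" using that f by (auto simp: support_def)
    then have "\<not> r < i" "i = r \<Longrightarrow> k \<le> degree (f $ r)" using below by (auto intro: le_degree)
    then show ?thesis unfolding Q by (cases "i = r") auto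
  qed
qed

lemma pivot_lead_pos:
  assumes f: "f \<in> carrier_vec n" "f \<noteq> 0\<^sub>v n"
  shows "f $ fst (lead_pos f) \<noteq> 0"
    and "fst (lead_pos f) < k \<Longrightarrow> k < n \<Longrightarrow> f $ k = 0"
proof -
  show "f $ fst (lead_pos f) \<noteq> 0"
    using lead_coefficient_nonzero[OF f] by (auto simp: coeff_at_def)
  show "f $ k = 0" if "fst (lead_pos f) < k" "k < n"
  proof (rule ccontr)
    assume "f $ k \<noteq> 0"
    then have "(k, degree (f $ k)) \<in> support f" using f that by (simp add: support_def)
    from le_lead_pos[OF this] that show False by (auto simp: less_eq_prod_def)
  qed
qed

text \<open>
Blocks collect the columns whose leading monomials lie in the same row; increasing pivot rows together
with increasing degrees inside the blocks amount to increasing leading positions.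
\<close>

lemma generalized_hermite_normal_form_iff:
  assumes fs: "set fs \<subseteq> carrier_vec n"
  shows "generalized_hermite_normal_form (mat_of_cols n fs) \<longleftrightarrow>
    0\<^sub>v n \<notin> set fs \<and> sorted_wrt (\<lambda>f g. lead_pos f < lead_pos g) fs \<and> hermite_pairs (set fs) \<and>
    (\<forall>f\<in>set fs. G_reduced (set fs - {f}) f)" (is "?l \<longleftrightarrow> ?r")
proof
  let ?A = "mat_of_cols n fs"
  have cols: "set (cols ?A) = set fs" using fs by (simp add: cols_mat_of_cols)
  have col: "col ?A m = fs ! m" if "m < length fs" for m
    using that fs by (simp add: subset_iff)
  {
    assume ?l
    then obtain t r l where echelon: "block_echelon ?A t r l"
      and deg: "\<forall>i<t. \<forall>j1 j2. j1 < j2 \<longrightarrow> j2 < l i \<longrightarrow>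
        degree (block_col ?A l i j1 $ r i) < degree (block_col ?A l i j2 $ r i)"
      and dvd: "\<forall>i<t. \<forall>j1 j2. j1 < j2 \<longrightarrow> j2 < l i \<longrightarrow>
        lead_coeff (block_col ?A l i j2 $ r i) dvd lead_coeff (block_col ?A l i j1 $ r i)"
      and zero: "\<forall>i<t. \<forall>j1 j2. j1 < j2 \<longrightarrow> j2 < l i \<longrightarrow> reduces_to_zero (set fs)
        (monom 1 (degree (block_col ?A l i j2 $ r i) - degree (block_col ?A l i j1 $ r i)) \<cdot>\<^sub>v
            block_col ?A l i j1 -
          [:lead_coeff (block_col ?A l i j1 $ r i) div lead_coeff (block_col ?A l i j2 $ r i):] \<cdot>\<^sub>v
            block_col ?A l i j2)"
      and red: "\<forall>i<t. \<forall>j<l i. G_reduced (set fs - {block_col ?A l i j}) (block_col ?A l i j)"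
      unfolding generalized_hermite_normal_form_def Let_def cols
      by (elim exE conjE) (rule that)
    have len: "length fs = (\<Sum>i<t. l i)" and r: "\<And>i. i < t \<Longrightarrow> r i < n"
      and mono: "\<And>i1 i2. i1 < i2 \<Longrightarrow> i2 < t \<Longrightarrow> r i1 < r i2"
      using echelon unfolding block_echelon_def by auto
    have c: "block_col ?A l i j = fs ! ((\<Sum>k<i. l k) + j)" "block_col ?A l i j \<in> carrier_vec n"
      if "i < t" "j < l i" for i j
      using col[of "(\<Sum>k<i. l k) + j"] block_index_less[of i t j l, OF that] fs
      unfolding len[symmetric] block_col_def by auto
    have piv: "block_col ?A l i j $ r i \<noteq> 0" "\<And>k. r i < k \<Longrightarrow> k < n \<Longrightarrow> block_col ?A l i j $ k = 0"
      if "i < t" "j < l i" for i j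
      using echelon that unfolding block_echelon_def by auto
    have lp: "lead_pos (block_col ?A l i j) = (r i, degree (block_col ?A l i j $ r i))"
      if "i < t" "j < l i" for i j
      by (rule lead_pos_pivot[OF c(2)[OF that] r[OF that(1)] piv[OF that]])
    have lc: "lead_coefficient (block_col ?A l i j) = lead_coeff (block_col ?A l i j $ r i)"
      if "i < t" "j < l i" for i j
      unfolding lp[OF that] by (simp add: coeff_at_def)
    have block: "\<exists>i<t. \<exists>j<l i. m = (\<Sum>k<i. l k) + j \<and> fs ! m = block_col ?A l i j" if "m < length fs" for m
      using block_index_exists[of m l t] that c(1) unfolding len by metis
    have blockE: "\<exists>i<t. \<exists>j<l i. f = block_col ?A l i j" if "f \<in> set fs" for f
      using that block by (metis in_set_conv_nth)
    show ?r
    proof (intro conjI)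
      show "0\<^sub>v n \<notin> set fs"
      proof
        assume "0\<^sub>v n \<in> set fs"
        then obtain i j where "i < t" "j < l i" "0\<^sub>v n = block_col ?A l i j" using blockE by blast
        then show False using piv(1)[of i j] r[of i] by (metis index_zero_vec(1))
      qed
      show "sorted_wrt (\<lambda>f g. lead_pos f < lead_pos g) fs" unfolding sorted_wrt_iff_nth_less
      proof (intro allI impI)
        fix p q assume pq: "p < q" "q < length fs"
        obtain i1 j1 where p: "i1 < t" "j1 < l i1" "p = (\<Sum>k<i1. l k) + j1" "fs ! p = block_col ?A l i1 j1"
          using block[of p] pq by auto
        obtain i2 j2 where q: "i2 < t" "j2 < l i2" "q = (\<Sum>k<i2. l k) + j2" "fs ! q = block_col ?A l i2 j2"
          using block[of q] pq by auto
        have "\<not> i2 < i1" using block_index_less[of i2 i1 j2 l] p q pq by auto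
        then consider "i1 < i2" | "i1 = i2" "j1 < j2" using pq p q by fastforce
        then show "lead_pos (fs ! p) < lead_pos (fs ! q)"
        proof cases
          case 1
          then show ?thesis using mono q p lp by auto
        next
          case 2
          then show ?thesis using deg[rule_format, of i2 j1 j2] q p lp by auto
        qed
      qed
      show "hermite_pairs (set fs)" unfolding hermite_pairs_def
      proof (intro ballI impI)
        fix f g assume fg: "f \<in> set fs" "g \<in> set fs" "f \<noteq> g" "fst (lead_pos f) = fst (lead_pos g)"
          "snd (lead_pos f) \<le> snd (lead_pos g)"
        obtain i1 j1 where p: "i1 < t" "j1 < l i1" "f = block_col ?A l i1 j1" using blockE fg by blast
        obtain i2 j2 where q: "i2 < t" "j2 < l i2" "g = block_col ?A l i2 j2" using blockE fg by blast
        have "r i1 = r i2" using fg(4) p q lp by simp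
        then have i: "i1 = i2" using mono p(1) q(1) by (metis less_irrefl linorder_neqE_nat)
        have "\<not> j2 < j1" using deg[rule_format, of i1 j2 j1] fg(5) p q lp i by auto
        then have j: "j1 < j2" using fg(3) p q i by (metis linorder_neqE_nat)
        show "snd (lead_pos f) < snd (lead_pos g) \<and> lead_coefficient g dvd lead_coefficient f \<and>
          reduces_to_zero (set fs) (S_vector f g)"
          using deg[rule_format, OF q(1) j q(2)] dvd[rule_format, OF q(1) j q(2)]
            zero[rule_format, OF q(1) j q(2)] p q lp lc i
          unfolding S_vector_def by simp
      qed
      show "\<forall>f\<in>set fs. G_reduced (set fs - {f}) f" using blockE red by blast
    qed
  }
  {
    assume ?r
    then have nz: "0\<^sub>v n \<notin> set fs" and sorted: "sorted_wrt (\<lambda>f g. lead_pos f < lead_pos g) fs"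
      and pairs: "hermite_pairs (set fs)" and red: "\<forall>f\<in>set fs. G_reduced (set fs - {f}) f" by auto
    have "sorted (map (fst \<circ> lead_pos) fs)"
      unfolding sorted_map
      by (rule sorted_wrt_mono_rel[OF _ sorted]) (auto simp: less_prod_def)
    from sorted_block_decomposition[OF this] obtain t :: nat and r l where
        *: "\<forall>i<t. 0 < l i \<and> r i \<in> set (map (fst \<circ> lead_pos) fs)"
        and mono: "\<forall>i1 i2. i1 < i2 \<longrightarrow> i2 < t \<longrightarrow> r i1 < r i2"
        and "length (map (fst \<circ> lead_pos) fs) = (\<Sum>i<t. l i)"
        and **: "\<forall>i<t. \<forall>j<l i. map (fst \<circ> lead_pos) fs ! ((\<Sum>k<i. l k) + j) = r i"
      by (elim exE conjE) (rule that)
    then have len: "length fs = (\<Sum>i<t. l i)" by simp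
    have pos: "0 < l i" "r i \<in> set (map (fst \<circ> lead_pos) fs)" if "i < t" for i using * that by auto
    have nth: "map (fst \<circ> lead_pos) fs ! ((\<Sum>k<i. l k) + j) = r i" if "i < t" "j < l i" for i j
      using ** that by blast
    have f: "f \<in> carrier_vec n" "f \<noteq> 0\<^sub>v n" if "f \<in> set fs" for f using that fs nz by auto
    have idx: "(\<Sum>k<i. l k) + j < length fs" if "i < t" "j < l i" for i j
      unfolding len using that by (rule block_index_less)
    have c: "block_col ?A l i j = fs ! ((\<Sum>k<i. l k) + j)" "block_col ?A l i j \<in> set fs"
      if "i < t" "j < l i" for i j
      using col idx[OF that] unfolding block_col_def by auto
    have row: "fst (lead_pos (block_col ?A l i j)) = r i" if "i < t" "j < l i" for i j
      using nth[OF that] idx[OF that] c(1)[OF that] by simp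
    have piv: "block_col ?A l i j $ r i \<noteq> 0" "\<And>k. r i < k \<Longrightarrow> k < n \<Longrightarrow> block_col ?A l i j $ k = 0"
      if "i < t" "j < l i" for i j
      using pivot_lead_pos[OF f[OF c(2)[OF that]]] unfolding row[OF that] by blast+
    have r: "r i < n" if "i < t" for i
      using pos(2)[OF that] fst_lead_pos_less[OF f] by auto
    have lp: "lead_pos (block_col ?A l i j) = (r i, degree (block_col ?A l i j $ r i))"
      if "i < t" "j < l i" for i j
      using lead_pos_pivot[OF f(1)[OF c(2)[OF that]] r[OF that(1)] piv[OF that]] .
    have lc: "lead_coefficient (block_col ?A l i j) = lead_coeff (block_col ?A l i j $ r i)"
      if "i < t" "j < l i" for i j
      unfolding lp[OF that] by (simp add: coeff_at_def)
    have echelon: "block_echelon ?A t r l"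
      unfolding block_echelon_def using pos(1) r mono len piv by simp
    have pair: "degree (block_col ?A l i j1 $ r i) < degree (block_col ?A l i j2 $ r i) \<and>
      lead_coeff (block_col ?A l i j2 $ r i) dvd lead_coeff (block_col ?A l i j1 $ r i) \<and>
      reduces_to_zero (set fs) (monom 1 (degree (block_col ?A l i j2 $ r i) - degree (block_col ?A l i j1 $ r i)) \<cdot>\<^sub>v block_col ?A l i j1
        - [:lead_coeff (block_col ?A l i j1 $ r i) div lead_coeff (block_col ?A l i j2 $ r i):] \<cdot>\<^sub>v block_col ?A l i j2)"
      if "i < t" "j1 < j2" "j2 < l i" for i j1 j2
    proof -
      let ?c = "block_col ?A l i j1" and ?c' = "block_col ?A l i j2"
      have j1: "j1 < l i" using that by simp
      have "lead_pos ?c < lead_pos ?c'" unfolding c(1)[OF that(1) j1] c(1)[OF that(1,3)]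
        using sorted_wrt_nth_less[OF sorted _ idx[OF that(1,3)]] that(2) by simp
      then have "?c \<noteq> ?c'" and "fst (lead_pos ?c) = fst (lead_pos ?c')"
        and "snd (lead_pos ?c) \<le> snd (lead_pos ?c')"
        unfolding lp[OF that(1) j1] lp[OF that(1,3)] by auto
      then have "snd (lead_pos ?c) < snd (lead_pos ?c') \<and> lead_coefficient ?c' dvd lead_coefficient ?c \<and>
          reduces_to_zero (set fs) (S_vector ?c ?c')"
        using pairs c(2)[OF that(1) j1] c(2)[OF that(1,3)] unfolding hermite_pairs_def by blast
      then show ?thesis
        unfolding S_vector_def lc[OF that(1) j1] lc[OF that(1,3)]
        unfolding lp[OF that(1) j1] lp[OF that(1,3)] snd_conv .
    qed
    have red': "G_reduced (set fs - {block_col ?A l i j}) (block_col ?A l i j)" if "i < t" "j < l i" for i j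
      using red c(2)[OF that] by blast
    show ?l unfolding generalized_hermite_normal_form_def Let_def cols
      by (intro exI[of _ t] exI[of _ r] exI[of _ l] conjI allI impI echelon red')
        (simp_all only: pair)
  }
qed

theorem theorem3p9:
  fixes n :: nat and fs :: "int poly vec list"
  assumes "set fs \<subseteq> carrier_vec n"
  shows "(reduced_groebner_basis n (set fs) \<and> sorted_wrt vec_less fs)
     \<longleftrightarrow> generalized_hermite_normal_form (mat_of_cols n fs)"
proof -
  have fin: "finite (set fs)" by simp
  have less: "vec_less (fs ! p) (fs ! q) \<longleftrightarrow> lead_pos (fs ! p) < lead_pos (fs ! q)"
    if nz: "0\<^sub>v n \<notin> set fs" and pairs: "hermite_pairs (set fs)" and pq: "p < q" "q < length fs" for p q
  proof -
    have mem: "fs ! p \<in> set fs" "fs ! q \<in> set fs" using pq by auto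
    then have c: "fs ! p \<in> carrier_vec n" "fs ! p \<noteq> 0\<^sub>v n" "fs ! q \<in> carrier_vec n" "fs ! q \<noteq> 0\<^sub>v n"
      using assms nz by auto
    have "fs ! p = fs ! q" if "lead_pos (fs ! p) = lead_pos (fs ! q)"
    proof (rule ccontr)
      assume "fs ! p \<noteq> fs ! q"
      with pairs mem have "snd (lead_pos (fs ! p)) < snd (lead_pos (fs ! q))"
        unfolding hermite_pairs_def using that by (metis order_refl)
      then show False using that by simp
    qed
    then show ?thesis unfolding vec_less_iff[OF c] by auto
  qed
  show ?thesis
  proof
    assume L: "reduced_groebner_basis n (set fs) \<and> sorted_wrt vec_less fs"
    then have nz: "0\<^sub>v n \<notin> set fs" and strong: "strong_groebner_basis n (set fs)"
      and red: "\<forall>f\<in>set fs. G_reduced (set fs - {f}) f"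
      unfolding reduced_groebner_basis_def strong_groebner_basis_def groebner_basis_def by auto
    have "\<forall>f \<in> module_span n (set fs). f \<noteq> 0\<^sub>v n \<longrightarrow>
        (\<exists>g\<in>set fs. lead_divides g (lead_coefficient f) (lead_pos f))"
      using strong unfolding strong_groebner_basis_iff[OF fin assms nz] .
    then have pairs: "hermite_pairs (set fs)"
      using red by (intro strong_reduced_hermite_pairs[OF assms nz]) auto
    have "sorted_wrt (\<lambda>f g. lead_pos f < lead_pos g) fs"
      using L less[OF nz pairs] by (simp add: sorted_wrt_iff_nth_less)
    then show "generalized_hermite_normal_form (mat_of_cols n fs)"
      unfolding generalized_hermite_normal_form_iff[OF assms] using nz pairs red by blast
  next
    assume "generalized_hermite_normal_form (mat_of_cols n fs)"
    then have nz: "0\<^sub>v n \<notin> set fs" and sorted: "sorted_wrt (\<lambda>f g. lead_pos f < lead_pos g) fs"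
      and pairs: "hermite_pairs (set fs)" and red: "\<forall>f\<in>set fs. G_reduced (set fs - {f}) f"
      unfolding generalized_hermite_normal_form_iff[OF assms] by auto
    have "strong_groebner_basis n (set fs)"
      unfolding strong_groebner_basis_iff[OF fin assms nz]
      using hermite_pairs_lead_divides[OF fin assms nz pairs] by blast
    moreover have "sorted_wrt vec_less fs"
      using sorted less[OF nz pairs] by (simp add: sorted_wrt_iff_nth_less)
    ultimately show "reduced_groebner_basis n (set fs) \<and> sorted_wrt vec_less fs"
      unfolding reduced_groebner_basis_def using red by blast
  qed
qed

end
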